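(* Let $G\colon\mathcal H\to\mathcal H$ be $\kappa$-Lipschitz continuous and $\eta$-strongly monotone, where $\kappa,\eta>0$, and let $C:=\bigcap_{i\in I}C_i\subseteq\mathcal H$ be nonempty, where for each $i\in I:=\{1,\ldots,m\}$, $C_i$ is closed and convex. For each $k=0,1,2,\ldots$, let $U_k\colon\mathcal H\to\mathcal H$ be $\rho_k$-strongly quasi-nonexpansive such that $C\subseteq\operatorname{Fix}U_k$, let $\lambda_k\in[0,\infty)$, and consider the method $$u^0\in\mathcal H;\qquad u^{k+1}=U_ku^k-\lambda_kGU_ku^k .$$ Assume that $\rho:=\inf_k\rho_k>0$, $\lim_k\lambda_k=0$ and $\sum_k\lambda_k=\infty$. Moreover, assume that there is an integer $s\ge 0$ such that for every $i\in I$ there are indices $l_k\in\{k,k+1,\ldots,k+s-1\}$, $k=0,1,2,\ldots$ (depending on $i$), for which the sequence $\{U_{l_k}\}_{k=0}^\infty$ is $C_i$-regular, and that the family $\{C_i\mid i\in I\}$ is boundedly regular. Then $u^k$ converges strongly to the unique solution of $\mathrm{VI}(G,C)$.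
   Context: $\mathcal H$ is a real Hilbert space, $\operatorname{Fix}U:=\{x\in\mathcal H\mid Ux=x\}$, and $d(x,C):=\inf_{y\in C}\|x-y\|$. $G$ is $\eta$-strongly monotone if $\langle Gx-Gy,x-y\rangle\ge\eta\|x-y\|^2$ for all $x,y\in\mathcal H$. The variational inequality problem $\mathrm{VI}(G,C)$ is to find $\bar u\in C$ with $\langle G\bar u,u-\bar u\rangle\ge 0$ for all $u\in C$; it has a unique solution when $G$ is Lipschitz continuous and strongly monotone and $C$ is nonempty, closed and convex. For $\rho\ge 0$, an operator $T\colon\mathcal H\to\mathcal H$ is $\rho$-strongly quasi-nonexpansive if $\operatorname{Fix}T\ne\emptyset$ and $\|Tu-z\|^2\le\|u-z\|^2-\rho\|Tu-u\|^2$ for all $u\in\mathcal H$, $z\in\operatorname{Fix}T$; it is quasi-nonexpansive if this holds with $\rho=0$. For $D\subseteq\mathcal H$ nonempty, closed and convex, a sequence $\{V_k\}_{k=0}^\infty$ of quasi-nonexpansive operators $V_k\colon\mathcal H\to\mathcal H$ is $D$-regular if for every sequence $\{x^k\}_{k=0}^\infty\subseteq\mathcal H$, $\|V_kx^k-x^k\|\to 0$ implies $d(x^k,D)\to 0$. (Applied to $V_k:=U_{l_k}$.) A family of closed convex sets $C_i$, $i\in I=\{1,\ldots,m\}$, with $C=\bigcap_{i\in I}C_i\neq\emptyset$ is boundedly regular if for every bounded sequence $\{x^k\}_{k=0}^\infty\subseteq\mathcal H$, $\max_{i\in I}d(x^k,C_i)\to 0$ implies $d(x^k,C)\to 0$.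 *)

theory Defs
  imports "HOL-Analysis.Analysis"
begin

text \<open>
  A real Hilbert space is a type of sort \<open>{real_inner, complete_space}\<close>. The distance
  \<open>d(x,C)\<close> is the library's \<open>infdist x C\<close>; note that \<open>infdist x {} = 0\<close>, so the
  nonemptiness requirements below are not redundant.
\<close>

definition Fix :: "('a \<Rightarrow> 'a) \<Rightarrow> 'a set"
  where "Fix T = {x. T x = x}"

definition strongly_monotone :: "real \<Rightarrow> ('a::real_inner \<Rightarrow> 'a) \<Rightarrow> bool"
  where "strongly_monotone \<eta> G \<longleftrightarrow>
    (\<forall>x y. (G x - G y) \<bullet> (x - y) \<ge> \<eta> * (norm (x - y))\<^sup>2)"

definition VI_solution :: "('a::real_inner \<Rightarrow> 'a) \<Rightarrow> 'a set \<Rightarrow> 'a \<Rightarrow> bool"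
  where "VI_solution G C v \<longleftrightarrow> v \<in> C \<and> (\<forall>w\<in>C. G v \<bullet> (w - v) \<ge> 0)"

definition strongly_quasi_nonexpansive :: "real \<Rightarrow> ('a::real_normed_vector \<Rightarrow> 'a) \<Rightarrow> bool"
  where "strongly_quasi_nonexpansive \<rho> T \<longleftrightarrow> \<rho> \<ge> 0 \<and> Fix T \<noteq> {} \<and>
    (\<forall>u. \<forall>z\<in>Fix T. (norm (T u - z))\<^sup>2 \<le> (norm (u - z))\<^sup>2 - \<rho> * (norm (T u - u))\<^sup>2)"

definition quasi_nonexpansive :: "('a::real_normed_vector \<Rightarrow> 'a) \<Rightarrow> bool"
  where "quasi_nonexpansive T \<longleftrightarrow> strongly_quasi_nonexpansive 0 T"

definition regular_operators ::
    "'a::real_normed_vector set \<Rightarrow> (nat \<Rightarrow> 'a \<Rightarrow> 'a) \<Rightarrow> bool"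
  where "regular_operators D V \<longleftrightarrow>
    D \<noteq> {} \<and> closed D \<and> convex D \<and> (\<forall>k. quasi_nonexpansive (V k)) \<and>
    (\<forall>x :: nat \<Rightarrow> 'a. (\<lambda>k. norm (V k (x k) - x k)) \<longlonglongrightarrow> 0 \<longrightarrow>
       (\<lambda>k. infdist (x k) D) \<longlonglongrightarrow> 0)"

text \<open>The maximum is meaningful for finite nonempty \<open>I\<close> only.\<close>

definition boundedly_regular ::
    "'i set \<Rightarrow> ('i \<Rightarrow> 'a::real_normed_vector set) \<Rightarrow> bool"
  where "boundedly_regular I C \<longleftrightarrow>
    (\<forall>i\<in>I. closed (C i) \<and> convex (C i)) \<and> (\<Inter>i\<in>I. C i) \<noteq> {} \<and>
    (\<forall>x :: nat \<Rightarrow> 'a. bounded (range x) \<longrightarrow>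
       (\<lambda>k. MAX i\<in>I. infdist (x k) (C i)) \<longlonglongrightarrow> 0 \<longrightarrow>
       (\<lambda>k. infdist (x k) (\<Inter>i\<in>I. C i)) \<longlonglongrightarrow> 0)"

end

theory Submission
  imports Defs
begin

text \<open>
  Let \<open>S\<close> be the intersection of the \<open>C i\<close>, \<open>v\<close> the solution of the variational inequality, and put
  \<open>y k = U k (u k)\<close>, \<open>a k = \<parallel>u k - v\<parallel>\<^sup>2\<close>, \<open>e k = \<parallel>y k - u k\<parallel>\<close>. One step of the method combines two
  effects: \<open>U k\<close> lowers the squared distance to \<open>v\<close> by at least \<open>r (e k)\<^sup>2\<close>, where \<open>r > 0\<close> bounds all
  the \<open>\<rho> k\<close> from below, and the gradient-like step changes it by
  \<open>- 2 lam k \<langle>G (y k), y k - v\<rangle> + O((lam k)\<^sup>2)\<close>. The iterates are bounded because \<open>x - l G x\<close> is a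
  contraction in \<open>x\<close> for small \<open>l > 0\<close> (\<open>strongly_monotone_step_contraction\<close>); applied with a
  projection, the same contraction yields \<open>v\<close> by Banach's theorem.

  Suppose \<open>a k \<ge> \<epsilon>\<close> with \<open>k\<close> large, and look at the residuals \<open>e k, ..., e (k + s - 1)\<close>. If one of them
  is not small, then \<open>a\<close> drops by a fixed amount within \<open>s\<close> steps, since the steps \<open>lam\<close> are
  negligible there. If all are small, then the iterates hardly move during the window, which contains
  a regular operator for every \<open>C i\<close>; hence \<open>u k\<close> is near every \<open>C i\<close>, and near \<open>S\<close> by bounded
  regularity (\<open>window_residuals_imp_infdist\<close>). Near \<open>S\<close> the variational inequality makes
  \<open>\<langle>G v, y k - v\<rangle>\<close> almost nonnegative, so that \<open>\<langle>G (y k), y k - v\<rangle>\<close> is at least a positive multiple of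
  \<open>\<eta> \<epsilon>\<close> by strong monotonicity, and \<open>a\<close> drops by a multiple of \<open>lam k\<close> in a single step.

  Both kinds of drop are at least a constant times the sum of the \<open>lam k\<close> passed over. That sum diverges, so
  \<open>a\<close> must fall below \<open>\<epsilon>\<close>, and it cannot climb far back above it (\<open>tendsto_zero_by_jumps\<close>).
\<close>

section \<open>Projections and variational inequalities in Hilbert space\<close>

text \<open>
  The points of \<open>S\<close> at almost minimal distance from \<open>x\<close> form nested closed sets, whose diameters tend
  to zero by the parallelogram law.
\<close>

lemma nearest_point_exists:
  fixes S :: "'a::{real_inner, complete_space} set"
  assumes "closed S" "convex S" "S \<noteq> {}"
  obtains p where "p \<in> S" "\<And>w. w \<in> S \<Longrightarrow> dist x p \<le> dist x w"
proof -
  define d where "d = infdist x S"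
  define N where "N n = S \<inter> cball x (d + 1 / real (Suc n))" for n
  have d0: "0 \<le> d" by (simp add: d_def infdist_nonneg)
  have near: "\<exists>w\<in>S. dist x w < d + e" if "e > 0" for e
    using that assms(3) cINF_less_iff[of S "dist x" "d + e"]
    by (auto simp: d_def infdist_notempty)
  have nest: "N n \<subseteq> N m" if "m \<le> n" for m n
  proof -
    have "1 / real (Suc n) \<le> 1 / real (Suc m)" using that by (simp add: frac_le)
    then show ?thesis unfolding N_def by auto
  qed
  have small: "\<exists>n. \<forall>a\<in>N n. \<forall>b\<in>N n. dist a b < e" if e: "e > 0" for e
  proof -
    have "(\<lambda>n. 4 * (d + 1 / real (Suc n))\<^sup>2 - 4 * d\<^sup>2) \<longlonglongrightarrow> 4 * (d + 0)\<^sup>2 - 4 * d\<^sup>2"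
      by (intro tendsto_intros LIMSEQ_Suc lim_1_over_n)
    then have "eventually (\<lambda>n. 4 * (d + 1 / real (Suc n))\<^sup>2 - 4 * d\<^sup>2 < e\<^sup>2) sequentially"
      using e by (intro order_tendstoD) auto
    then obtain n where n: "4 * (d + 1 / real (Suc n))\<^sup>2 - 4 * d\<^sup>2 < e\<^sup>2"
      by (auto simp: eventually_sequentially)
    have "dist a b < e" if a: "a \<in> N n" and b: "b \<in> N n" for a b
    proof -
      define c where "c = (1/2) *\<^sub>R a + (1/2) *\<^sub>R b"
      have "c \<in> S" unfolding c_def
        using a b assms(2) by (intro convexD) (auto simp: N_def)
      then have "d \<le> norm (x - c)" by (metis d_def dist_norm infdist_le)
      then have dc: "d\<^sup>2 \<le> (norm (x - c))\<^sup>2" using d0 by (intro power_mono) auto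
      have na: "(norm (x - a))\<^sup>2 \<le> (d + 1 / real (Suc n))\<^sup>2"
        using a by (intro power_mono) (auto simp: N_def dist_norm)
      have nb: "(norm (x - b))\<^sup>2 \<le> (d + 1 / real (Suc n))\<^sup>2"
        using b by (intro power_mono) (auto simp: N_def dist_norm)
      \<comment> \<open>the parallelogram law, with \<open>c\<close> the midpoint of \<open>a\<close> and \<open>b\<close>\<close>
      have "(norm (a - b))\<^sup>2 = 2 * (norm (x - a))\<^sup>2 + 2 * (norm (x - b))\<^sup>2 - 4 * (norm (x - c))\<^sup>2"
        unfolding c_def power2_norm_eq_inner
        by (simp add: inner_simps algebra_simps inner_commute)
      then have "(norm (a - b))\<^sup>2 < e\<^sup>2" using dc na nb n by linarith
      then show ?thesis using e by (simp add: dist_norm power2_less_imp_less)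
    qed
    then show ?thesis by blast
  qed
  obtain p where p: "\<And>n. p \<in> N n"
  proof (rule decreasing_closed_nest[of N])
    show "closed (N n)" for n using assms(1) by (simp add: N_def closed_Int)
    show "N n \<noteq> {}" for n using near[of "1 / real (Suc n)"] by (force simp: N_def)
  qed (use nest small in auto)
  have "(\<lambda>n. d + 1 / real (Suc n)) \<longlonglongrightarrow> d + 0"
    by (intro tendsto_intros LIMSEQ_Suc lim_1_over_n)
  then have "dist x p \<le> d + 0"
    using p by (intro Lim_bounded2[where N = 0]) (auto simp: N_def)
  then show thesis
    using that[of p] p[of 0] by (auto simp: d_def N_def intro: order_trans infdist_le)
qed

text \<open>
  Expanding the square gives the factor \<open>1 - 2 l \<eta> + l\<^sup>2 \<kappa>\<^sup>2 \<le> 1 - l \<eta> \<le> (1 - l \<eta> / 2)\<^sup>2\<close>. The bound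
  linear in \<open>l\<close> is what balances the perturbation \<open>l \<parallel>G v\<parallel>\<close> when the iterates are shown to be bounded.
\<close>

lemma strongly_monotone_step_contraction:
  fixes G :: "'a::real_inner \<Rightarrow> 'a"
  assumes lip: "\<kappa>-lipschitz_on UNIV G" and mon: "strongly_monotone \<eta> G"
    and l: "0 \<le> l" "l * \<kappa>\<^sup>2 \<le> \<eta>" "l * \<eta> \<le> 1"
  shows "norm ((x - l *\<^sub>R G x) - (y - l *\<^sub>R G y)) \<le> (1 - l * \<eta> / 2) * norm (x - y)"
proof (rule power2_le_imp_le)
  have "norm (G x - G y) \<le> \<kappa> * norm (x - y)"
    using lipschitz_onD[OF lip, of x y] by (simp add: dist_norm)
  then have "(norm (G x - G y))\<^sup>2 \<le> (\<kappa> * norm (x - y))\<^sup>2"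
    by (intro power_mono) auto
  then have "l\<^sup>2 * (norm (G x - G y))\<^sup>2 \<le> l\<^sup>2 * (\<kappa> * norm (x - y))\<^sup>2"
    by (intro mult_left_mono) auto
  also have "\<dots> = (l * \<kappa>\<^sup>2) * (l * (norm (x - y))\<^sup>2)"
    by (simp add: power2_eq_square)
  also have "\<dots> \<le> \<eta> * (l * (norm (x - y))\<^sup>2)"
    using l by (intro mult_right_mono) auto
  finally have g2: "l\<^sup>2 * (norm (G x - G y))\<^sup>2 \<le> l * \<eta> * (norm (x - y))\<^sup>2"
    by (simp add: mult_ac)
  have "l * (\<eta> * (norm (x - y))\<^sup>2) \<le> l * ((G x - G y) \<bullet> (x - y))"
    using mon l by (intro mult_left_mono) (auto simp: strongly_monotone_def)
  moreover have "(norm ((x - l *\<^sub>R G x) - (y - l *\<^sub>R G y)))\<^sup>2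
      = (norm (x - y))\<^sup>2 - 2 * (l * ((G x - G y) \<bullet> (x - y))) + l\<^sup>2 * (norm (G x - G y))\<^sup>2"
    unfolding power2_norm_eq_inner
    by (simp add: inner_simps algebra_simps inner_commute power2_eq_square)
  ultimately have "(norm ((x - l *\<^sub>R G x) - (y - l *\<^sub>R G y)))\<^sup>2 \<le> (1 - l * \<eta>) * (norm (x - y))\<^sup>2"
    using g2 by (simp add: algebra_simps)
  also have "\<dots> \<le> (1 - l * \<eta> / 2)\<^sup>2 * (norm (x - y))\<^sup>2"
    using zero_le_power2[of "l * \<eta> / 2"]
    by (intro mult_right_mono) (auto simp: power2_eq_square algebra_simps)
  finally show "(norm ((x - l *\<^sub>R G x) - (y - l *\<^sub>R G y)))\<^sup>2 \<le> ((1 - l * \<eta> / 2) * norm (x - y))\<^sup>2"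
    by (simp add: power_mult_distrib)
  show "0 \<le> (1 - l * \<eta> / 2) * norm (x - y)" using l by simp
qed

text \<open>
  With \<open>P\<close> the projection onto \<open>S\<close>, the solutions are the fixed points of \<open>P (x - l G x)\<close>, which is a
  contraction for small \<open>l > 0\<close> since \<open>P\<close> is nonexpansive.
\<close>

lemma VI_solution_unique_exists:
  fixes G :: "'a::{real_inner, complete_space} \<Rightarrow> 'a"
  assumes "\<kappa> > 0" and "\<eta> > 0" and lip: "\<kappa>-lipschitz_on UNIV G" and mon: "strongly_monotone \<eta> G"
    and S: "closed S" "convex S" "S \<noteq> {}"
  shows "\<exists>!v. VI_solution G S v"
proof -
  define l where "l = min (\<eta> / \<kappa>\<^sup>2) (1 / \<eta>)"
  have l: "0 < l" "l * \<kappa>\<^sup>2 \<le> \<eta>" "l * \<eta> \<le> 1"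
    using assms(1,2) by (auto simp: l_def min_def field_simps)
  have "\<exists>P. \<forall>x. P x \<in> S \<and> (\<forall>w\<in>S. (x - P x) \<bullet> (w - P x) \<le> 0)"
  proof (intro choice allI)
    fix x
    obtain p where p: "p \<in> S" "\<And>w. w \<in> S \<Longrightarrow> dist x p \<le> dist x w"
      using nearest_point_exists[OF S] by blast
    then show "\<exists>p. p \<in> S \<and> (\<forall>w\<in>S. (x - p) \<bullet> (w - p) \<le> 0)"
      using any_closest_point_dot[OF S(2,1)] by blast
  qed
  then obtain P where P: "\<And>x. P x \<in> S" "\<And>x w. w \<in> S \<Longrightarrow> (x - P x) \<bullet> (w - P x) \<le> 0"
    by blast
  have nonexp: "norm (P x - P y) \<le> norm (x - y)" for x y
  proof -
    have "(x - P x) \<bullet> (P y - P x) \<le> 0" "(y - P y) \<bullet> (P x - P y) \<le> 0" using P by auto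
    then have "(norm (P x - P y))\<^sup>2 \<le> (x - y) \<bullet> (P x - P y)"
      unfolding power2_norm_eq_inner by (simp add: inner_simps algebra_simps inner_commute)
    also have "\<dots> \<le> norm (x - y) * norm (P x - P y)" by (rule norm_cauchy_schwarz)
    finally have "norm (P x - P y) * norm (P x - P y) \<le> norm (x - y) * norm (P x - P y)"
      by (simp add: power2_eq_square)
    then show ?thesis by (cases "norm (P x - P y) = 0") (auto dest: mult_right_le_imp_le)
  qed
  define F where "F x = P (x - l *\<^sub>R G x)" for x
  have "\<exists>!x. F x = x"
  proof (rule banach_fix_type)
    show "0 \<le> 1 - l * \<eta> / 2" "1 - l * \<eta> / 2 < 1" using l assms(2) by auto
    show "\<forall>x y. dist (F x) (F y) \<le> (1 - l * \<eta> / 2) * dist x y"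
      unfolding F_def dist_norm
      using order_trans[OF nonexp strongly_monotone_step_contraction[OF lip mon]] l
      by (meson less_imp_le)
  qed
  then obtain v where v: "F v = v" by blast
  have "VI_solution G S v"
    unfolding VI_solution_def
  proof (intro conjI ballI)
    show "v \<in> S" using v P(1) by (metis F_def)
    fix w assume "w \<in> S"
    then have "((v - l *\<^sub>R G v) - v) \<bullet> (w - v) \<le> 0"
      using P(2)[of w "v - l *\<^sub>R G v"] v by (simp add: F_def)
    then show "0 \<le> G v \<bullet> (w - v)" using l(1) by (simp add: zero_le_mult_iff)
  qed
  moreover have "a = b" if "VI_solution G S a" "VI_solution G S b" for a b
  proof -
    have "G a \<bullet> (b - a) \<ge> 0" "G b \<bullet> (a - b) \<ge> 0" using that by (auto simp: VI_solution_def)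
    then have "(G a - G b) \<bullet> (a - b) \<le> 0" by (simp add: inner_simps algebra_simps)
    moreover have "\<eta> * (norm (a - b))\<^sup>2 \<le> (G a - G b) \<bullet> (a - b)"
      using mon by (simp add: strongly_monotone_def)
    ultimately have "\<eta> * (norm (a - b))\<^sup>2 \<le> 0" by simp
    then show ?thesis using assms(2) by (simp add: mult_le_0_iff)
  qed
  ultimately show ?thesis by blast
qed

section \<open>Two facts about real sequences\<close>

text \<open>
  While \<open>a k \<ge> \<epsilon>\<close>, one can jump from \<open>k\<close> to one of the next \<open>s\<close> indices, lowering \<open>a\<close> by at least a
  constant times the \<open>lam\<close>-mass jumped over; divergence of \<open>\<Sum> lam\<close> ends this at a value
  below \<open>\<epsilon>\<close>. From then on every \<open>s\<close> consecutive indices contain one with \<open>a k \<le> 2 \<epsilon>\<close>, and the growth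
  condition controls the indices in between. This replaces the usual case distinction between
  eventually decreasing sequences and sequences that increase infinitely often.
\<close>

lemma tendsto_zero_by_jumps:
  fixes a lam :: "nat \<Rightarrow> real"
  assumes a: "\<And>k. a k \<ge> 0" and lam: "\<And>k. lam k \<ge> 0" "lam \<longlonglongrightarrow> 0"
    and div: "filterlim (\<lambda>n. \<Sum>k<n. lam k) at_top sequentially"
    and grow: "\<And>k. a (Suc k) \<le> a k + M * lam k" and M: "M \<ge> 0" and s: "s \<ge> 1"
    and jump: "\<And>\<epsilon>. \<epsilon> > 0 \<Longrightarrow> \<exists>\<delta>>0. \<exists>c>0. \<forall>\<^sub>F k in sequentially.
      a k \<ge> \<epsilon> \<longrightarrow> a (k + s) \<le> a k - \<delta> \<or> a (Suc k) \<le> a k - c * lam k"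
  shows "a \<longlonglongrightarrow> 0"
proof -
  define S where "S n = (\<Sum>k<n. lam k)" for n
  have S_mono: "S m \<le> S n" if "m \<le> n" for m n
    unfolding S_def using that lam(1) by (intro sum_mono2) auto
  have win: "(\<lambda>k. S (k + s) - S k) \<longlonglongrightarrow> 0"
  proof -
    have "S (k + t) - S k = (\<Sum>j<t. lam (k + j))" for k t
      by (induction t) (auto simp: S_def)
    moreover have "(\<lambda>k. \<Sum>j<s. lam (k + j)) \<longlonglongrightarrow> (\<Sum>j<s. 0)"
      by (intro tendsto_sum LIMSEQ_ignore_initial_segment lam(2))
    ultimately show ?thesis by simp
  qed
  have small_win: "\<forall>\<^sub>F k in sequentially. b * (S (k + s) - S k) \<le> e" if "e > 0" for b e :: real
  proof -
    have "(\<lambda>k. b * (S (k + s) - S k)) \<longlonglongrightarrow> 0" using tendsto_mult_left[OF win, of b] by simp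
    from order_tendstoD(2)[OF this that] show ?thesis by (rule eventually_mono) simp
  qed
  have drift: "a (k + t) \<le> a k + M * (S (k + t) - S k)" for k t
  proof (induction t)
    case (Suc t)
    have "a (k + Suc t) \<le> a (k + t) + M * lam (k + t)" using grow[of "k + t"] by simp
    then show ?case using Suc by (simp add: S_def algebra_simps)
  qed simp
  have ev3: "\<forall>\<^sub>F n in sequentially. a n \<le> 3 * \<epsilon>" if e: "\<epsilon> > 0" for \<epsilon>
  proof -
    obtain \<delta> c where dc: "\<delta> > 0" "c > 0"
      and ev: "\<forall>\<^sub>F k in sequentially. a k \<ge> \<epsilon> \<longrightarrow> a (k + s) \<le> a k - \<delta> \<or> a (Suc k) \<le> a k - c * lam k"
      using jump[OF e] by blast
    have "\<forall>\<^sub>F k in sequentially. (a k \<ge> \<epsilon> \<longrightarrow> a (k + s) \<le> a k - \<delta> \<or> a (Suc k) \<le> a k - c * lam k)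
        \<and> c * (S (k + s) - S k) \<le> \<delta> \<and> M * (S (k + s) - S k) \<le> \<epsilon>"
      by (intro eventually_conj ev small_win dc e)
    then obtain K where K: "\<And>k. k \<ge> K \<Longrightarrow> a k \<ge> \<epsilon> \<Longrightarrow> a (k + s) \<le> a k - \<delta> \<or> a (Suc k) \<le> a k - c * lam k"
      and Kd: "\<And>k. k \<ge> K \<Longrightarrow> c * (S (k + s) - S k) \<le> \<delta>"
      and Ke: "\<And>k. k \<ge> K \<Longrightarrow> M * (S (k + s) - S k) \<le> \<epsilon>"
      unfolding eventually_sequentially by blast
    \<comment> \<open>neither alternative increases \<open>a + c S\<close>: in the first one, \<open>\<delta>\<close> pays for the growth of \<open>c S\<close>\<close>
    have J: "\<exists>k'>k. k' \<le> k + s \<and> a k' + c * S k' \<le> a k + c * S k" if k: "k \<ge> K" "a k \<ge> \<epsilon>" for k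
      using K[OF k]
    proof
      assume "a (k + s) \<le> a k - \<delta>"
      then show ?thesis using Kd[OF k(1)] s
        by (intro exI[of _ "k + s"]) (auto simp: algebra_simps)
    next
      assume "a (Suc k) \<le> a k - c * lam k"
      then show ?thesis using s
        by (intro exI[of _ "Suc k"]) (auto simp: algebra_simps S_def)
    qed
    obtain N where N: "N \<ge> K" "a N < \<epsilon>"
    proof (rule ccontr)
      assume "\<not> thesis"
      then have big: "a n \<ge> \<epsilon>" if "n \<ge> K" for n using that \<open>\<And>N. K \<le> N \<Longrightarrow> a N < \<epsilon> \<Longrightarrow> thesis\<close> by force
      have "\<exists>k\<ge>K + n. a k + c * S k \<le> a K + c * S K" for n
      proof (induction n)
        case (Suc n)
        then obtain k where k: "k \<ge> K + n" "a k + c * S k \<le> a K + c * S K" by blast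
        have "k \<ge> K" using k(1) by simp
        from J[OF this big[OF this]] obtain k' where k': "k' > k" "a k' + c * S k' \<le> a k + c * S k"
          by blast
        show ?case using k k' by (intro exI[of _ k']) simp
      qed auto
      then have bound: "c * S n \<le> a K + c * S K" for n
      proof -
        obtain k where k: "k \<ge> K + n" "a k + c * S k \<le> a K + c * S K"
          using \<open>\<And>n. \<exists>k\<ge>K + n. a k + c * S k \<le> a K + c * S K\<close> by blast
        have "c * S n \<le> c * S k" using S_mono[of n k] k(1) dc by simp
        then show ?thesis using k(2) a[of k] by linarith
      qed
      have "\<forall>\<^sub>F n in sequentially. S n > (a K + c * S K) / c"
        using div unfolding S_def filterlim_at_top_dense by blast
      then obtain n where "S n > (a K + c * S K) / c" by (auto simp: eventually_sequentially)
      then show False using bound[of n] dc by (simp add: field_simps)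
    qed
    have next2: "\<exists>k'>k. k' \<le> k + s \<and> a k' \<le> 2 * \<epsilon>" if k: "k \<ge> K" "a k \<le> 2 * \<epsilon>" for k
    proof (cases "a k \<ge> \<epsilon>")
      case True
      then obtain k' where k': "k' > k" "k' \<le> k + s" "a k' + c * S k' \<le> a k + c * S k"
        using J k by blast
      moreover have "c * S k \<le> c * S k'" using S_mono[of k k'] k'(1) dc by simp
      ultimately show ?thesis using k by (intro exI[of _ k']) auto
    next
      case False
      have "M * (S (Suc k) - S k) \<le> M * (S (k + s) - S k)"
        using S_mono[of "Suc k" "k + s"] s M by (intro mult_left_mono) auto
      then have "a (Suc k) \<le> 2 * \<epsilon>" using drift[of k 1] Ke[OF k(1)] False by simp
      then show ?thesis using s by (intro exI[of _ "Suc k"]) auto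
    qed
    have "a n \<le> 3 * \<epsilon>" if n: "n \<ge> N" for n
    proof -
      \<comment> \<open>the last good index up to \<open>n\<close> lies within distance \<open>s\<close> of \<open>n\<close>, by \<open>next2\<close>\<close>
      define Q where "Q = {k. N \<le> k \<and> k \<le> n \<and> a k \<le> 2 * \<epsilon>}"
      define k where "k = Max Q"
      have fin: "finite Q" by (auto simp: Q_def intro: finite_subset[of _ "{..n}"])
      moreover have "N \<in> Q" using n N e by (auto simp: Q_def)
      ultimately have "k \<in> Q" unfolding k_def by (intro Max_in) auto
      then have k: "N \<le> k" "k \<le> n" "a k \<le> 2 * \<epsilon>" by (auto simp: Q_def)
      then obtain k' where k': "k' > k" "k' \<le> k + s" "a k' \<le> 2 * \<epsilon>"
        using next2[of k] N by auto
      have "k' \<notin> Q" using fin k'(1) Max_ge[of Q k'] by (metis k_def not_less)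
      then have "n < k + s" using k k' by (auto simp: Q_def)
      then have "M * (S n - S k) \<le> M * (S (k + s) - S k)"
        using S_mono[of n "k + s"] M by (intro mult_left_mono) auto
      then show ?thesis using drift[of k "n - k"] Ke[of k] k N by simp
    qed
    then show ?thesis by (auto simp: eventually_sequentially)
  qed
  have "\<forall>\<^sub>F n in sequentially. dist (a n) 0 < e" if "e > 0" for e
  proof -
    have "\<forall>\<^sub>F n in sequentially. a n \<le> 3 * (e / 4)" using that by (intro ev3) simp
    then show ?thesis by (rule eventually_mono) (use that a in \<open>simp add: abs_of_nonneg\<close>)
  qed
  then show ?thesis by (simp add: tendsto_iff)
qed

text \<open>
  Regularity is a statement about whole sequences, whereas the descent argument needs a threshold at
  single indices. Sequences masked by an arbitrary index set \<open>A\<close> bridge the gap: if no threshold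
  \<open>\<delta>\<close> worked, then the range of a strictly increasing sequence of counterexamples would be a mask
  along which \<open>w\<close> tends to zero while \<open>d\<close> stays above \<open>\<epsilon>\<close>.
\<close>

lemma masked_limits_imp_threshold:
  fixes w d :: "nat \<Rightarrow> real"
  assumes w: "\<And>k. w k \<ge> 0"
    and lim: "\<And>A. (\<lambda>k. if k \<in> A then w k else 0) \<longlonglongrightarrow> 0 \<Longrightarrow> (\<lambda>k. if k \<in> A then d k else 0) \<longlonglongrightarrow> 0"
    and e: "\<epsilon> > 0"
  shows "\<exists>\<delta>>0. \<forall>\<^sub>F k in sequentially. w k < \<delta> \<longrightarrow> d k < \<epsilon>"
proof (rule ccontr)
  assume neg: "\<not> ?thesis"
  have ex: "\<exists>k>K. w k < 1 / real (Suc n) \<and> d k \<ge> \<epsilon>" for n K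
  proof -
    have "\<not> (\<forall>\<^sub>F k in sequentially. w k < 1 / real (Suc n) \<longrightarrow> d k < \<epsilon>)"
      using neg by (simp del: of_nat_Suc)
    then show ?thesis unfolding eventually_sequentially
      by (metis Suc_le_eq not_less)
  qed
  have "\<exists>f. \<forall>n. (w (f n) < 1 / real (Suc n) \<and> d (f n) \<ge> \<epsilon>) \<and> f n < f (Suc n)"
    by (rule dependent_nat_choice) (use ex in blast)+
  then obtain f where f: "\<And>n. w (f n) < 1 / real (Suc n)" "\<And>n. d (f n) \<ge> \<epsilon>" "\<And>n. f n < f (Suc n)"
    by blast
  have sm: "strict_mono f" using f(3) by (simp add: strict_mono_Suc_iff)
  have "(\<lambda>k. if k \<in> range f then w k else 0) \<longlonglongrightarrow> 0"
  proof (rule LIMSEQ_I)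
    fix r :: real assume "r > 0"
    then obtain n where n: "1 / real (Suc n) < r" using reals_Archimedean
      by (metis inverse_eq_divide)
    have "norm ((if k \<in> range f then w k else 0) - 0) < r" if "k \<ge> f n" for k
    proof (cases "k \<in> range f")
      case True
      then obtain m where m: "k = f m" by blast
      then have "n \<le> m" using that sm by (simp add: strict_mono_less_eq)
      then have "1 / real (Suc m) \<le> 1 / real (Suc n)" by (simp add: frac_le)
      then show ?thesis using f(1)[of m] n w[of k] True m by simp
    qed (use \<open>r > 0\<close> in simp)
    then show "\<exists>no. \<forall>k\<ge>no. norm ((if k \<in> range f then w k else 0) - 0) < r" by blast
  qed
  from lim[OF this] have "(\<lambda>k. if k \<in> range f then d k else 0) \<longlonglongrightarrow> 0" .
  from LIMSEQ_subseq_LIMSEQ[OF this sm] have "(\<lambda>n. d (f n)) \<longlonglongrightarrow> 0" by (simp add: o_def)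
  then have "\<epsilon> \<le> 0" using f(2) by (intro LIMSEQ_le_const) auto
  then show False using e by simp
qed

section \<open>Perturbed iterations of regular operators\<close>

text \<open>
  Where all residuals of the window \<open>k, ..., k + s - 1\<close> are small, \<open>u k\<close> is close to \<open>u (l k)\<close> for the
  index \<open>l k\<close> of the regular operator for \<open>C i\<close>, and \<open>u (l k)\<close> is close to \<open>C i\<close> by regularity.
  The mask \<open>A\<close> singles out the windows for which this is known.
\<close>

lemma window_residuals_imp_infdist:
  fixes u :: "nat \<Rightarrow> 'a::real_normed_vector"
  assumes I: "finite I" "I \<noteq> {}"
    and reg: "\<And>i. i \<in> I \<Longrightarrow>
      \<exists>l. (\<forall>k. l k \<in> {k..<k + s}) \<and> regular_operators (C i) (\<lambda>k. U (l k))"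
    and breg: "boundedly_regular I C"
    and fixed: "\<And>k. (\<Inter>i\<in>I. C i) \<subseteq> Fix (U k)"
    and bdd: "bounded (range u)"
    and pert: "(\<lambda>k. norm (u (Suc k) - U k (u k))) \<longlonglongrightarrow> 0"
    and W: "(\<lambda>k. if k \<in> A then \<Sum>t<s. (norm (U (k + t) (u (k + t)) - u (k + t)))\<^sup>2 else 0) \<longlonglongrightarrow> 0"
  shows "(\<lambda>k. if k \<in> A then infdist (u k) (\<Inter>i\<in>I. C i) else 0) \<longlonglongrightarrow> 0"
proof -
  define S where "S = (\<Inter>i\<in>I. C i)"
  define e where "e k = norm (U k (u k) - u k)" for k
  define r where "r k = norm (u (Suc k) - U k (u k))" for k
  define w where "w k = (if k \<in> A then \<Sum>t<s. (e (k + t))\<^sup>2 else 0)" for k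
  define D where "D k = s * sqrt (w k) + (\<Sum>t<s. r (k + t))" for k
  obtain z where z: "z \<in> S" using breg by (auto simp: boundedly_regular_def S_def)
  have Uz: "U k z = z" for k using fixed[of k] z by (auto simp: S_def Fix_def)
  have sqrt_w: "(\<lambda>k. sqrt (w k)) \<longlonglongrightarrow> 0"
    using tendsto_real_sqrt[OF W] unfolding w_def e_def by simp
  have "(\<lambda>k. \<Sum>t<s. r (k + t)) \<longlonglongrightarrow> (\<Sum>t<s. 0)"
    using pert by (intro tendsto_sum LIMSEQ_ignore_initial_segment) (simp add: r_def[abs_def])
  then have D_lim: "D \<longlonglongrightarrow> 0"
    unfolding D_def[abs_def] using tendsto_add[OF tendsto_mult_left[OF sqrt_w, of "real s"]] by force
  have D_nonneg: "0 \<le> D k" for k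
    unfolding D_def w_def r_def by (auto intro!: add_nonneg_nonneg mult_nonneg_nonneg sum_nonneg)
  have e_le: "e (k + t) \<le> sqrt (w k)" if "k \<in> A" "t < s" for k t
  proof -
    have "(e (k + t))\<^sup>2 \<le> (\<Sum>t<s. (e (k + t))\<^sup>2)"
      using that(2) by (intro member_le_sum) auto
    then show ?thesis using that(1) by (simp add: w_def real_le_rsqrt)
  qed
  have inc: "norm (u (k + t) - u k) \<le> (\<Sum>j<t. e (k + j) + r (k + j))" for k t
  proof (induction t)
    case (Suc t)
    have "norm (u (k + Suc t) - u k)
        = norm ((u (Suc (k + t)) - U (k + t) (u (k + t))) + (U (k + t) (u (k + t)) - u (k + t))
          + (u (k + t) - u k))" by simp
    also have "\<dots> \<le> r (k + t) + e (k + t) + norm (u (k + t) - u k)"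
      unfolding r_def e_def by (intro norm_triangle_le add_right_mono norm_triangle_ineq)
    finally show ?case using Suc by simp
  qed simp
  have inc_D: "norm (u (k + t) - u k) \<le> D k" if "k \<in> A" "t < s" for k t
  proof -
    have "(\<Sum>j<t. e (k + j) + r (k + j)) \<le> (\<Sum>j<s. e (k + j) + r (k + j))"
      using that(2) by (intro sum_mono2) (auto simp: e_def r_def)
    also have "\<dots> \<le> (\<Sum>j<s. sqrt (w k) + r (k + j))"
      using e_le that(1) by (intro sum_mono) auto
    also have "\<dots> = D k" by (simp add: D_def sum.distrib)
    finally show ?thesis using inc[of k t] by linarith
  qed
  define y where "y k = (if k \<in> A then u k else z)" for k
  have y_lim: "(\<lambda>k. infdist (y k) (C i)) \<longlonglongrightarrow> 0" if i: "i \<in> I" for i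
  proof -
    obtain l where l: "\<And>k. l k \<in> {k..<k + s}" and ro: "regular_operators (C i) (\<lambda>k. U (l k))"
      using reg[OF i] by blast
    have l_eq: "l k = k + (l k - k)" "l k - k < s" for k using l[of k] by auto
    \<comment> \<open>off \<open>A\<close>, the common fixed point \<open>z\<close> fills the sequence without adding a residual\<close>
    define x where "x k = (if k \<in> A then u (l k) else z)" for k
    have "norm (U (l k) (x k) - x k) \<le> sqrt (w k)" for k
    proof (cases "k \<in> A")
      case True
      then show ?thesis using e_le[OF True l_eq(2)[of k]]
        unfolding l_eq(1)[of k, symmetric] by (simp add: x_def e_def)
    next
      case False
      then show ?thesis using Uz by (simp add: x_def w_def)
    qed
    then have "(\<lambda>k. norm (U (l k) (x k) - x k)) \<longlonglongrightarrow> 0"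
      by (intro tendsto_sandwich[OF _ _ tendsto_const sqrt_w]) auto
    then have x_lim: "(\<lambda>k. infdist (x k) (C i)) \<longlonglongrightarrow> 0"
      using ro by (auto simp: regular_operators_def)
    have "infdist (y k) (C i) \<le> infdist (x k) (C i) + D k" for k
    proof -
      have "dist (y k) (x k) \<le> D k"
        using inc_D[OF _ l_eq(2)[of k], of k] D_nonneg[of k]
        unfolding l_eq(1)[of k, symmetric] by (auto simp: x_def y_def dist_norm norm_minus_commute)
      then show ?thesis using infdist_triangle[of "y k" "C i" "x k"] by linarith
    qed
    moreover have upper: "(\<lambda>k. infdist (x k) (C i) + D k) \<longlonglongrightarrow> 0"
      using tendsto_add[OF x_lim D_lim] by simp
    ultimately show ?thesis
      by (intro tendsto_sandwich[OF _ _ tendsto_const upper]) (simp_all add: infdist_nonneg)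
  qed
  have "(\<lambda>k. \<Sum>i\<in>I. infdist (y k) (C i)) \<longlonglongrightarrow> (\<Sum>i\<in>I. 0)"
    using y_lim by (intro tendsto_sum) auto
  then have sum_lim: "(\<lambda>k. \<Sum>i\<in>I. infdist (y k) (C i)) \<longlonglongrightarrow> 0" by simp
  have "(MAX i\<in>I. infdist (y k) (C i)) \<le> (\<Sum>i\<in>I. infdist (y k) (C i))"
    and "0 \<le> (MAX i\<in>I. infdist (y k) (C i))" for k
    using I by (auto intro!: Max.boundedI member_le_sum simp: infdist_nonneg Max_ge_iff)
  then have "(\<lambda>k. MAX i\<in>I. infdist (y k) (C i)) \<longlonglongrightarrow> 0"
    by (intro tendsto_sandwich[OF _ _ tendsto_const sum_lim]) auto
  moreover have "bounded (range y)"
    by (rule bounded_subset[of "insert z (range u)"]) (use bdd in \<open>auto simp: y_def\<close>)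
  ultimately have "(\<lambda>k. infdist (y k) S) \<longlonglongrightarrow> 0"
    using breg by (auto simp: boundedly_regular_def S_def)
  moreover have "infdist (y k) S = (if k \<in> A then infdist (u k) S else 0)" for k
    using z by (simp add: y_def)
  ultimately show ?thesis unfolding S_def[symmetric] by simp
qed

section \<open>The hybrid steepest descent method\<close>

text \<open>
  By the contraction estimate, once \<open>l = lam k\<close> is small, the next distance to \<open>v\<close> is at most
  \<open>(1 - l \<eta> / 2) \<parallel>u k - v\<parallel> + l \<parallel>G v\<parallel>\<close>, a convex combination of \<open>\<parallel>u k - v\<parallel>\<close> and \<open>2 \<parallel>G v\<parallel> / \<eta>\<close>.
\<close>

lemma hybrid_iterates_bounded:
  fixes G :: "'a::real_inner \<Rightarrow> 'a"
  assumes eta: "\<eta> > 0" and lip: "\<kappa>-lipschitz_on UNIV G" and mon: "strongly_monotone \<eta> G"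
    and lam: "\<And>k. lam k \<ge> 0" "lam \<longlonglongrightarrow> 0"
    and qne: "\<And>k. norm (U k (u k) - v) \<le> norm (u k - v)"
    and step: "\<And>k. u (Suc k) = U k (u k) - lam k *\<^sub>R G (U k (u k))"
  obtains R where "\<And>k. norm (u k - v) \<le> R"
proof -
  have lim: "(\<lambda>k. lam k * c) \<longlonglongrightarrow> 0" for c
    using lam(2) by (rule tendsto_mult_left_zero)
  have "\<forall>\<^sub>F k in sequentially. lam k * \<kappa>\<^sup>2 < \<eta>" "\<forall>\<^sub>F k in sequentially. lam k * \<eta> < 1"
    using order_tendstoD(2)[OF lim eta] order_tendstoD(2)[OF lim zero_less_one] by auto
  then have "\<forall>\<^sub>F k in sequentially. lam k * \<kappa>\<^sup>2 < \<eta> \<and> lam k * \<eta> < 1" by (rule eventually_conj)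
  then obtain K where K: "\<And>k. k \<ge> K \<Longrightarrow> lam k * \<kappa>\<^sup>2 < \<eta> \<and> lam k * \<eta> < 1"
    unfolding eventually_sequentially by blast
  define R where "R = max (norm (u K - v)) (2 * norm (G v) / \<eta>)"
  have "2 * norm (G v) / \<eta> \<le> R" by (simp add: R_def)
  then have Gv: "norm (G v) \<le> \<eta> / 2 * R" using eta by (simp add: field_simps)
  have "norm (u (t + K) - v) \<le> R" for t
  proof (induction t)
    case (Suc t)
    define k where "k = t + K"
    define y where "y = U k (u k)"
    have k: "lam k * \<kappa>\<^sup>2 \<le> \<eta>" "lam k * \<eta> \<le> 1" using K[of k] by (auto simp: k_def)
    have "norm (u (Suc k) - v)
        = norm (((y - lam k *\<^sub>R G y) - (v - lam k *\<^sub>R G v)) - lam k *\<^sub>R G v)"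
      by (simp add: step y_def)
    also have "\<dots> \<le> norm ((y - lam k *\<^sub>R G y) - (v - lam k *\<^sub>R G v)) + lam k * norm (G v)"
      using norm_triangle_ineq4 lam(1)[of k] by (metis abs_of_nonneg norm_scaleR)
    also have "\<dots> \<le> (1 - lam k * \<eta> / 2) * norm (y - v) + lam k * norm (G v)"
      using strongly_monotone_step_contraction[OF lip mon lam(1) k] by simp
    also have "\<dots> \<le> (1 - lam k * \<eta> / 2) * R + lam k * (\<eta> / 2 * R)"
    proof (intro add_mono mult_left_mono Gv lam(1))
      show "norm (y - v) \<le> R" using qne[of k] Suc by (simp add: y_def k_def)
    qed (use k in simp)
    also have "\<dots> = R" by (simp add: algebra_simps)
    finally show ?case by (simp add: k_def)
  qed (simp add: R_def)
  then have "Bseq (\<lambda>t. u (t + K) - v)" by (intro BseqI')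
  then have "Bseq (\<lambda>k. u k - v)" by (rule Bseq_offset)
  then obtain R' where "\<forall>k. norm (u k - v) \<le> R'" by (auto elim: BseqE)
  then show thesis using that by blast
qed

theorem theorem6p4:
  fixes G :: "'a::{real_inner, complete_space} \<Rightarrow> 'a"
    and \<kappa> \<eta> :: real
    and m s :: nat
    and C :: "nat \<Rightarrow> 'a set"
    and U :: "nat \<Rightarrow> 'a \<Rightarrow> 'a"
    and \<rho> lam :: "nat \<Rightarrow> real"
    and u :: "nat \<Rightarrow> 'a"
  assumes "\<kappa> > 0" and "\<eta> > 0"
    and "\<kappa>-lipschitz_on UNIV G"
    and "strongly_monotone \<eta> G"
    and "m \<ge> 1"
    and "\<And>i. i \<in> {1..m} \<Longrightarrow> closed (C i) \<and> convex (C i)"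
    and "(\<Inter>i\<in>{1..m}. C i) \<noteq> {}"
    and "\<And>k. strongly_quasi_nonexpansive (\<rho> k) (U k)"
    and "\<And>k. (\<Inter>i\<in>{1..m}. C i) \<subseteq> Fix (U k)"
    and "\<And>k. lam k \<ge> 0"
    and "\<And>k. u (Suc k) = U k (u k) - lam k *\<^sub>R G (U k (u k))"
    and "(INF k. \<rho> k) > 0"
    and "lam \<longlonglongrightarrow> 0"
    and "filterlim (\<lambda>n. \<Sum>k<n. lam k) at_top sequentially"
    and "\<And>i. i \<in> {1..m} \<Longrightarrow>
      \<exists>l :: nat \<Rightarrow> nat. (\<forall>k. l k \<in> {k..<k + s}) \<and> regular_operators (C i) (\<lambda>k. U (l k))"
    and "boundedly_regular {1..m} C"
  shows "(\<exists>!v. VI_solution G (\<Inter>i\<in>{1..m}. C i) v) \<and>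
    u \<longlonglongrightarrow> (THE v. VI_solution G (\<Inter>i\<in>{1..m}. C i) v)"
proof -
  note lip = assms(3) and mon = assms(4) and lam = assms(10) and step = assms(11)
  define S where "S = (\<Inter>i\<in>{1..m}. C i)"
  have S: "closed S" "convex S" "S \<noteq> {}"
    unfolding S_def using assms(6,7) by (auto intro!: closed_INT convex_INT)
  have ex1: "\<exists>!v. VI_solution G S v"
    using VI_solution_unique_exists[OF assms(1,2) lip mon S] .
  define v where "v = (THE v. VI_solution G S v)"
  have v: "VI_solution G S v" unfolding v_def using ex1 by (rule theI')
  then have vS: "v \<in> S" and VI: "\<And>p. p \<in> S \<Longrightarrow> G v \<bullet> (p - v) \<ge> 0"
    by (auto simp: VI_solution_def)
  have s: "s \<ge> 1" using assms(15)[of 1] assms(5) by fastforce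
  define r where "r = (INF k. \<rho> k)"
  have r: "r > 0" using assms(12) by (simp add: r_def)
  have r_le: "r \<le> \<rho> k" for k
    unfolding r_def using assms(8)
    by (intro cINF_lower bdd_belowI[of _ 0]) (auto simp: strongly_quasi_nonexpansive_def)
  define y where "y k = U k (u k)" for k
  define e where "e k = norm (y k - u k)" for k
  define a where "a k = (norm (u k - v))\<^sup>2" for k
  have sq: "(norm (y k - v))\<^sup>2 \<le> a k - r * (e k)\<^sup>2" for k
  proof -
    have "v \<in> Fix (U k)" using assms(9) vS S_def by blast
    then have "(norm (y k - v))\<^sup>2 \<le> a k - \<rho> k * (e k)\<^sup>2"
      using assms(8)[of k] by (simp add: strongly_quasi_nonexpansive_def y_def a_def e_def)
    moreover have "r * (e k)\<^sup>2 \<le> \<rho> k * (e k)\<^sup>2" using r_le by (intro mult_right_mono) auto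
    ultimately show ?thesis by linarith
  qed
  have qne: "norm (y k - v) \<le> norm (u k - v)" for k
  proof (rule power2_le_imp_le)
    have "0 \<le> r * (e k)\<^sup>2" using r by simp
    then show "(norm (y k - v))\<^sup>2 \<le> (norm (u k - v))\<^sup>2" using sq[of k] unfolding a_def by linarith
  qed simp
  obtain R where R: "\<And>k. norm (u k - v) \<le> R"
    using hybrid_iterates_bounded[where U = U and u = u and v = v,
        OF assms(2) lip mon lam assms(13) qne[unfolded y_def] step] by blast
  have R0: "R \<ge> 0" using R[of 0] norm_ge_zero order_trans by blast
  have yR: "norm (y k - v) \<le> R" for k using qne[of k] R[of k] by linarith
  define B where "B = norm (G v) + \<kappa> * R"
  have B0: "B \<ge> 0" using assms(1) R0 by (simp add: B_def)
  have GB: "norm (G (y k)) \<le> B" for k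
  proof -
    have "norm (G (y k) - G v) \<le> \<kappa> * norm (y k - v)"
      using lipschitz_onD[OF lip, of "y k" v] by (simp add: dist_norm)
    also have "\<dots> \<le> \<kappa> * R" using yR assms(1) by simp
    finally show ?thesis using norm_triangle_sub[of "G (y k)" "G v"] by (simp add: B_def)
  qed
  obtain L where "L > 0" "\<forall>k. norm (lam k) \<le> L"
    using convergent_imp_Bseq[OF convergentI[OF assms(13)]] by (auto elim: BseqE)
  then have L: "lam k \<le> L" "L > 0" for k by (auto simp: abs_le_iff)
  have expand: "a (Suc k) = (norm (y k - v))\<^sup>2 - 2 * lam k * (G (y k) \<bullet> (y k - v))
      + (lam k)\<^sup>2 * (norm (G (y k)))\<^sup>2" for k
    unfolding a_def step y_def[symmetric] power2_norm_eq_inner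
    by (simp add: inner_simps algebra_simps inner_commute power2_eq_square)
  have quad: "(lam k)\<^sup>2 * (norm (G (y k)))\<^sup>2 \<le> lam k * (lam k * B\<^sup>2)" for k
  proof -
    have "(norm (G (y k)))\<^sup>2 \<le> B\<^sup>2" using GB by (intro power_mono) auto
    then have "(lam k)\<^sup>2 * (norm (G (y k)))\<^sup>2 \<le> (lam k)\<^sup>2 * B\<^sup>2" by (intro mult_left_mono) auto
    then show ?thesis by (simp add: power2_eq_square mult_ac)
  qed
  define M where "M = 2 * (B * R) + L * B\<^sup>2"
  have M0: "M \<ge> 0" using B0 R0 L(2) by (simp add: M_def)
  have descent: "a (Suc k) \<le> a k - r * (e k)\<^sup>2 + M * lam k" for k
  proof -
    have "- (G (y k) \<bullet> (y k - v)) \<le> norm (G (y k)) * norm (y k - v)"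
      using norm_cauchy_schwarz[of "- G (y k)" "y k - v"] by simp
    also have "\<dots> \<le> B * R" using GB yR B0 by (intro mult_mono) auto
    finally have "lam k * - (G (y k) \<bullet> (y k - v)) \<le> lam k * (B * R)"
      using lam by (intro mult_left_mono) auto
    moreover have "lam k * (lam k * B\<^sup>2) \<le> lam k * (L * B\<^sup>2)"
      using lam L by (intro mult_left_mono mult_right_mono) auto
    ultimately show ?thesis using expand[of k] quad[of k] sq[of k]
      by (simp add: M_def algebra_simps)
  qed
  \<comment> \<open>squares of the residuals are summed because it is these that the descent inequality controls\<close>
  define W where "W k = (\<Sum>t<s. (e (k + t))\<^sup>2)" for k
  have W0: "W k \<ge> 0" for k by (simp add: W_def sum_nonneg)
  have window: "a (k + s) \<le> a k - r * W k + M * (\<Sum>t<s. lam (k + t))" for k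
  proof -
    have "a (k + t) \<le> a k - r * (\<Sum>j<t. (e (k + j))\<^sup>2) + M * (\<Sum>j<t. lam (k + j))" for t
    proof (induction t)
      case (Suc t)
      then show ?case using descent[of "k + t"] by (simp add: algebra_simps)
    qed simp
    then show ?thesis by (simp add: W_def)
  qed
  have pert: "(\<lambda>k. norm (u (Suc k) - U k (u k))) \<longlonglongrightarrow> 0"
  proof (rule tendsto_sandwich[OF _ _ tendsto_const])
    show "(\<lambda>k. lam k * B) \<longlonglongrightarrow> 0" using assms(13) by (rule tendsto_mult_left_zero)
    show "\<forall>\<^sub>F k in sequentially. norm (u (Suc k) - U k (u k)) \<le> lam k * B"
      using lam GB by (auto simp: step y_def intro!: always_eventually mult_left_mono)
  qed simp
  have bdd: "bounded (range u)"
    using R by (intro bounded_subset[OF bounded_cball[of v R]]) (auto simp: dist_norm norm_minus_commute)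
  have threshold: "\<exists>\<delta>>0. \<forall>\<^sub>F k in sequentially. W k < \<delta> \<longrightarrow> infdist (u k) S < \<epsilon>" if "\<epsilon> > 0" for \<epsilon>
  proof (rule masked_limits_imp_threshold[OF W0 _ that])
    fix A :: "nat set"
    assume "(\<lambda>k. if k \<in> A then W k else 0) \<longlonglongrightarrow> 0"
    then show "(\<lambda>k. if k \<in> A then infdist (u k) S else 0) \<longlonglongrightarrow> 0"
      using assms(5) unfolding S_def W_def e_def y_def
      by (intro window_residuals_imp_infdist[where s = s and U = U] assms(9,15,16) pert bdd) auto
  qed
  have "a \<longlonglongrightarrow> 0"
  proof (rule tendsto_zero_by_jumps[OF _ lam assms(13,14) _ M0 s])
    show "a (Suc k) \<le> a k + M * lam k" for k
    proof -
      have "0 \<le> r * (e k)\<^sup>2" using r by simp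
      then show ?thesis using descent[of k] by linarith
    qed
    fix \<epsilon> :: real assume eps: "\<epsilon> > 0"
    define g where "g = norm (G v) + 1"
    have g: "g > 0" by (simp add: g_def add_nonneg_pos)
    \<comment> \<open>\<open>\<theta>\<close> will bound both \<open>e k\<close> and the distance from \<open>u k\<close> to \<open>S\<close>: the first bound keeps \<open>\<parallel>y k - v\<parallel>\<close>
      above \<open>sqrt \<epsilon> / 2\<close>, the second keeps the error in \<open>\<langle>G v, y k - v\<rangle>\<close> below a quarter of \<open>\<eta> \<epsilon> / 4\<close>\<close>
    define \<theta> where "\<theta> = min (sqrt \<epsilon> / 2) (\<eta> * \<epsilon> / (32 * g))"
    have th: "\<theta> > 0" "\<theta> \<le> sqrt \<epsilon> / 2" "2 * \<theta> * g \<le> \<eta> * \<epsilon> / 16"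
    proof -
      show "\<theta> > 0" "\<theta> \<le> sqrt \<epsilon> / 2" using eps g assms(2) by (auto simp: \<theta>_def)
      have "\<theta> \<le> \<eta> * \<epsilon> / (32 * g)" by (simp add: \<theta>_def)
      then show "2 * \<theta> * g \<le> \<eta> * \<epsilon> / 16" using g by (simp add: field_simps)
    qed
    obtain \<delta>\<^sub>0 where d0: "\<delta>\<^sub>0 > 0" "\<forall>\<^sub>F k in sequentially. W k < \<delta>\<^sub>0 \<longrightarrow> infdist (u k) S < \<theta>"
      using threshold[OF th(1)] by blast
    \<comment> \<open>the second bound is there since \<open>(e k)\<^sup>2 \<le> W k\<close>, so that \<open>W k < \<delta>\<close> also gives \<open>e k < \<theta>\<close>\<close>
    define \<delta> where "\<delta> = min \<delta>\<^sub>0 (\<theta>\<^sup>2)"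
    have d: "\<delta> > 0" using d0 th by (simp add: \<delta>_def)
    have "(\<lambda>k. M * (\<Sum>t<s. lam (k + t))) \<longlonglongrightarrow> M * (\<Sum>t<s. 0)"
      by (intro tendsto_intros LIMSEQ_ignore_initial_segment assms(13))
    then have ev1: "\<forall>\<^sub>F k in sequentially. M * (\<Sum>t<s. lam (k + t)) < r * \<delta> / 2"
      using d r by (intro order_tendstoD(2)) auto
    have "(\<lambda>k. lam k * B\<^sup>2) \<longlonglongrightarrow> 0" using assms(13) by (rule tendsto_mult_left_zero)
    then have ev2: "\<forall>\<^sub>F k in sequentially. lam k * B\<^sup>2 < \<eta> * \<epsilon> / 8"
      using eps assms(2) by (intro order_tendstoD(2)) auto
    have "\<forall>\<^sub>F k in sequentially. a k \<ge> \<epsilon> \<longrightarrow>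
        a (k + s) \<le> a k - r * \<delta> / 2 \<or> a (Suc k) \<le> a k - \<eta> * \<epsilon> / 4 * lam k"
      using d0(2) ev1 ev2
    proof eventually_elim
      case (elim k)
      show ?case
      proof (cases "W k \<ge> \<delta>")
        case True
        then have "r * \<delta> \<le> r * W k" using r by simp
        then show ?thesis using window[of k] elim(2) by simp
      next
        case False
        have "(e (k + 0))\<^sup>2 \<le> W k"
          unfolding W_def using s by (intro member_le_sum) auto
        then have "(e k)\<^sup>2 < \<theta>\<^sup>2" using False by (simp add: \<delta>_def)
        then have ek: "e k < \<theta>" using th(1) by (simp add: power2_less_imp_less)
        have "infdist (u k) S < \<theta>" using elim(1) False by (simp add: \<delta>_def)
        then obtain p where p: "p \<in> S" "dist (u k) p < \<theta>"
          using S(3) cINF_less_iff[of S "dist (u k)" \<theta>] by (auto simp: infdist_notempty)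
        have "norm (p - y k) \<le> norm (u k - p) + e k"
          using norm_triangle_ineq4[of "p - u k" "y k - u k"]
          by (simp add: e_def norm_minus_commute)
        then have "norm (p - y k) \<le> 2 * \<theta>" using p(2) ek by (simp add: dist_norm)
        moreover have "norm (G v) \<le> g" by (simp add: g_def)
        ultimately have "norm (G v) * norm (p - y k) \<le> g * (2 * \<theta>)"
          using g by (intro mult_mono) auto
        then have "G v \<bullet> (p - y k) \<le> \<eta> * \<epsilon> / 16"
          using norm_cauchy_schwarz[of "G v" "p - y k"] th(3) by (simp add: mult_ac)
        then have Gv: "G v \<bullet> (y k - v) \<ge> - (\<eta> * \<epsilon> / 16)"
          using VI[OF p(1)] by (simp add: inner_simps)
        show ?thesis
        proof (cases "a k \<ge> \<epsilon>")
          case True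
          then have "sqrt \<epsilon> \<le> norm (u k - v)" by (simp add: a_def real_le_lsqrt)
          also have "\<dots> \<le> norm (y k - v) + e k"
            using norm_triangle_ineq4[of "y k - v" "y k - u k"] by (simp add: e_def)
          finally have "sqrt \<epsilon> / 2 \<le> norm (y k - v)" using ek th(2) by linarith
          then have "(sqrt \<epsilon> / 2)\<^sup>2 \<le> (norm (y k - v))\<^sup>2" using eps by (intro power_mono) auto
          then have "\<eta> * (\<epsilon> / 4) \<le> \<eta> * (norm (y k - v))\<^sup>2"
            using eps assms(2) by (simp add: power_divide)
          also have "\<dots> \<le> (G (y k) - G v) \<bullet> (y k - v)"
            using mon by (simp add: strongly_monotone_def)
          finally have "G (y k) \<bullet> (y k - v) \<ge> 3 * (\<eta> * \<epsilon> / 16)"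
            using Gv by (simp add: inner_simps)
          then have "lam k * (3 * (\<eta> * \<epsilon> / 16)) \<le> lam k * (G (y k) \<bullet> (y k - v))"
            using lam by (intro mult_left_mono) auto
          moreover have "lam k * (lam k * B\<^sup>2) \<le> lam k * (\<eta> * \<epsilon> / 8)"
            using lam elim(3) by (intro mult_left_mono) auto
          moreover have "0 \<le> r * (e k)\<^sup>2" using r by simp
          ultimately have "a (Suc k) \<le> a k - \<eta> * \<epsilon> / 4 * lam k"
            using expand[of k] quad[of k] sq[of k] by (simp add: algebra_simps)
          then show ?thesis by simp
        qed simp
      qed
    qed
    moreover have "r * \<delta> / 2 > 0" "\<eta> * \<epsilon> / 4 > 0" using r d eps assms(2) by auto
    ultimately show "\<exists>\<delta>>0. \<exists>c>0. \<forall>\<^sub>F k in sequentially.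
        a k \<ge> \<epsilon> \<longrightarrow> a (k + s) \<le> a k - \<delta> \<or> a (Suc k) \<le> a k - c * lam k"
      by blast
  qed (simp add: a_def)
  then have "(\<lambda>k. sqrt (a k)) \<longlonglongrightarrow> sqrt 0" by (rule tendsto_real_sqrt)
  then have "(\<lambda>k. norm (u k - v)) \<longlonglongrightarrow> 0" by (simp add: a_def)
  then have "u \<longlonglongrightarrow> v" by (simp add: tendsto_norm_zero_iff Lim_null[symmetric])
  then show ?thesis using ex1 by (simp add: v_def S_def)
qed

end
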